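(* Consider the online non-preemptive total weighted flow-time plus energy minimization problem on unrelated machines in the speed-scaling model with power function $P(s)=s^{\alpha}$, $\alpha>1$. For any $\epsilon>0$, there exists an online algorithm that rejects jobs of total weight at most $\epsilon\sum_{j}w_j$ and is $O\!\left(\left(1+\frac{1}{\epsilon}\right)^{\frac{\alpha}{\alpha-1}}\right)$-competitive, i.e., its total weighted flow-time of non-rejected jobs plus its total energy consumption is at most $O\!\left(\left(1+\frac{1}{\epsilon}\right)^{\frac{\alpha}{\alpha-1}}\right)$ times the optimal value of $\sum_j w_jF_j+\sum_i\int_0^\infty s_i(t)^\alpha\,dt$ over non-preemptive schedules of all jobs.
   Context: Problem: a set $\mathcal{M}$ of unrelated machines; each machine $i$ can run at a variable speed $s_i(t)\ge 0$ and consumes power $s_i(t)^{\alpha}$, where $\alpha>1$ is a constant. Jobs arrive online; each job $j$ has a weight $w_j$, release time $r_j$, and a machine-dependent volume $p_{ij}$ for each $i\in\mathcal{M}$, all known only at time $r_j$. A non-preemptive schedule processes each job continuously (without interruption) on a single machine, starting no earlier than $r_j$, at a constant speed during its whole execution (a job of volume $p_{ij}$ run at speed $s$ takes time $p_{ij}/s$); several jobs may be processed in parallel on the same machine, the machine speed being the sum of their speeds. With completion time $C_j$ and flow-time $F_j=C_j-r_j$, the objective is $\sum_j w_jF_j+\sum_{i}\int_0^\infty s_i(t)^\alpha\,dt$. The online algorithm may reject (not complete) jobs; its cost counts only the non-rejected jobs' weighted flow-times plus all energy it consumes, compared with the optimal offline non-preemptive schedule of all jobs. *)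

theory Defs
  imports "HOL-Analysis.Analysis"
begin

text \<open>
  Machines and jobs are named by natural numbers; \<open>volume I i j\<close> is the volume of job \<open>j\<close>
  on machine \<open>i\<close>. Data of an instance outside \<open>jobs I\<close> (and outside the machine set) is junk
  that none of the notions below depends on.
\<close>

record sched_instance =
  jobs :: "nat set"
  weight :: "nat \<Rightarrow> real"
  release :: "nat \<Rightarrow> real"
  volume :: "nat \<Rightarrow> nat \<Rightarrow> real"

definition valid_instance :: "nat set \<Rightarrow> sched_instance \<Rightarrow> bool" where
  "valid_instance M I \<longleftrightarrow>
     finite (jobs I) \<and>
     (\<forall>j\<in>jobs I. 0 < weight I j \<and> 0 \<le> release I j \<and> (\<forall>i\<in>M. 0 < volume I i j))"

text \<open>
  Non-preemptiveness and constant speed are built into the type: a job has at most one run,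
  on one machine, with one starting time and one speed. Runs on the same machine may overlap.
  A job that is rejected while running is interrupted for good at its rejection time.
\<close>

record run =
  machine :: nat
  start :: real
  speed :: real

record schedule =
  run_of :: "nat \<Rightarrow> run option"
  reject_at :: "nat \<Rightarrow> real option"

definition valid_run :: "nat set \<Rightarrow> sched_instance \<Rightarrow> nat \<Rightarrow> run \<Rightarrow> bool" where
  "valid_run M I j x \<longleftrightarrow> machine x \<in> M \<and> release I j \<le> start x \<and> 0 < speed x"

definition completion :: "sched_instance \<Rightarrow> nat \<Rightarrow> run \<Rightarrow> real" where
  "completion I j x = start x + volume I (machine x) j / speed x"

text \<open>
  Every job is either completed, or rejected while waiting, or rejected during its run
  (strictly before completion).
\<close>

definition feasible :: "nat set \<Rightarrow> sched_instance \<Rightarrow> schedule \<Rightarrow> bool" where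
  "feasible M I S \<longleftrightarrow>
     (\<forall>j\<in>jobs I.
        case run_of S j of
          None \<Rightarrow> (\<exists>\<rho>. reject_at S j = Some \<rho> \<and> release I j \<le> \<rho>)
        | Some x \<Rightarrow> valid_run M I j x \<and>
            (\<forall>\<rho>. reject_at S j = Some \<rho> \<longrightarrow> start x \<le> \<rho> \<and> \<rho> < completion I j x))"

definition rejected :: "sched_instance \<Rightarrow> schedule \<Rightarrow> nat set" where
  "rejected I S = {j \<in> jobs I. reject_at S j \<noteq> None}"

definition stop_time :: "sched_instance \<Rightarrow> schedule \<Rightarrow> nat \<Rightarrow> run \<Rightarrow> real" where
  "stop_time I S j x = (case reject_at S j of None \<Rightarrow> completion I j x | Some \<rho> \<Rightarrow> \<rho>)"

definition job_speed :: "sched_instance \<Rightarrow> schedule \<Rightarrow> nat \<Rightarrow> nat \<Rightarrow> real \<Rightarrow> real" where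
  "job_speed I S i j t =
     (case run_of S j of
        None \<Rightarrow> 0
      | Some x \<Rightarrow> if machine x = i \<and> start x \<le> t \<and> t < stop_time I S j x then speed x else 0)"

definition machine_speed :: "sched_instance \<Rightarrow> schedule \<Rightarrow> nat \<Rightarrow> real \<Rightarrow> real" where
  "machine_speed I S i t = (\<Sum>j\<in>jobs I. job_speed I S i j t)"

text \<open>
  For a feasible schedule of a valid instance the integrand is a nonnegative step function
  with bounded support, so the Bochner integral is the genuine energy. It includes the
  energy spent on jobs that are rejected later.
\<close>

definition energy :: "real \<Rightarrow> nat set \<Rightarrow> sched_instance \<Rightarrow> schedule \<Rightarrow> real" where
  "energy \<alpha> M I S = (\<Sum>i\<in>M. LBINT t:{0..}. machine_speed I S i t powr \<alpha>)"

definition flow_time :: "sched_instance \<Rightarrow> schedule \<Rightarrow> nat \<Rightarrow> real" where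
  "flow_time I S j = completion I j (the (run_of S j)) - release I j"

definition cost :: "real \<Rightarrow> nat set \<Rightarrow> sched_instance \<Rightarrow> schedule \<Rightarrow> real" where
  "cost \<alpha> M I S =
     (\<Sum>j\<in>jobs I - rejected I S. weight I j * flow_time I S j) + energy \<alpha> M I S"

text \<open>
  For nonempty \<open>M\<close> the infimum is over a nonempty set of nonnegative reals.
\<close>

definition opt_cost :: "real \<Rightarrow> nat set \<Rightarrow> sched_instance \<Rightarrow> real" where
  "opt_cost \<alpha> M I = Inf {cost \<alpha> M I S | S. feasible M I S \<and> rejected I S = {}}"

definition released_by :: "real \<Rightarrow> sched_instance \<Rightarrow> nat set" where
  "released_by t I = {j \<in> jobs I. release I j \<le> t}"

definition agree_until :: "nat set \<Rightarrow> real \<Rightarrow> sched_instance \<Rightarrow> sched_instance \<Rightarrow> bool" where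
  "agree_until M t I I' \<longleftrightarrow>
     released_by t I = released_by t I' \<and>
     (\<forall>j\<in>released_by t I.
        weight I j = weight I' j \<and> release I j = release I' j \<and>
        (\<forall>i\<in>M. volume I i j = volume I' i j))"

definition run_by :: "real \<Rightarrow> schedule \<Rightarrow> nat \<Rightarrow> run option" where
  "run_by t S j =
     (case run_of S j of None \<Rightarrow> None | Some x \<Rightarrow> if start x \<le> t then Some x else None)"

definition reject_by :: "real \<Rightarrow> schedule \<Rightarrow> nat \<Rightarrow> real option" where
  "reject_by t S j =
     (case reject_at S j of None \<Rightarrow> None | Some \<rho> \<Rightarrow> if \<rho> \<le> t then Some \<rho> else None)"

text \<open>
  A (deterministic) online algorithm is a non-anticipating map from instances to schedules:
  all decisions taken up to time \<open>t\<close> are determined by the jobs released up to time \<open>t\<close>.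
\<close>

definition online_algorithm :: "nat set \<Rightarrow> (sched_instance \<Rightarrow> schedule) \<Rightarrow> bool" where
  "online_algorithm M A \<longleftrightarrow>
     (\<forall>I. valid_instance M I \<longrightarrow> feasible M I (A I)) \<and>
     (\<forall>I I' t. valid_instance M I \<longrightarrow> valid_instance M I' \<longrightarrow> agree_until M t I I' \<longrightarrow>
        (\<forall>j\<in>released_by t I.
           run_by t (A I) j = run_by t (A I') j \<and> reject_by t (A I) j = reject_by t (A I') j))"

end

theory Submission
  imports Defs
begin

text \<open>
  Runs on one machine may overlap and only interact through the energy, so the weighted flow
  time is a separable cost of the chosen runs. Hence no rejection is needed at all: commit each
  job at its release to a run whose marginal cost is within a factor 2 of the best possible one
  (a minimiser is avoided that way). Comparing every choice with the run that an arbitrary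
  schedule with speeds \<open>b\<^sub>j\<close>, \<open>B = (\<Sum>j. b\<^sub>j)\<close> uses and summing up, the total cost is at most twice
  the flow time of that schedule plus twice the integral of
  \<open>\<Sum>j. (a\<^sub>j + b\<^sub>j) powr \<alpha> - a\<^sub>j powr \<alpha>\<close>, where \<open>a\<^sub>j \<le> a\<close> are
  partial loads of the greedy schedule. By smoothness of the power function, this sum is at most
  \<open>\<lambda> * B powr \<alpha> + a powr \<alpha> / 4\<close> with \<open>\<lambda>\<close> depending on \<open>\<alpha>\<close> only, and the second term is
  absorbed by the energy on the left-hand side.
\<close>

section \<open>Smoothness of the power function\<close>

lemma powr_eq_mult_powr:
  fixes x :: real
  assumes "0 \<le> x"
  shows "x powr a = x * x powr (a - 1)"
  using assms by (cases "x = 0") (simp_all add: powr_diff)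

text \<open>Splitting off one factor leaves the exponent \<open>\<alpha> - 1 \<ge> 0\<close>, so the
  remaining base may be enlarged to \<open>a + b\<close>. Later this bounds the energy increase
  caused by a run below by what the run uses alone.\<close>

lemma powr_superadditive:
  fixes a b :: real
  assumes "1 \<le> \<alpha>" "0 \<le> a" "0 \<le> b"
  shows "a powr \<alpha> + b powr \<alpha> \<le> (a + b) powr \<alpha>"
proof -
  have "a powr \<alpha> + b powr \<alpha> = a * a powr (\<alpha> - 1) + b * b powr (\<alpha> - 1)"
    using assms powr_eq_mult_powr by metis
  also have "\<dots> \<le> a * (a + b) powr (\<alpha> - 1) + b * (a + b) powr (\<alpha> - 1)"
    using assms by (intro add_mono mult_left_mono powr_mono2) auto
  also have "\<dots> = (a + b) powr \<alpha>"
    using assms powr_eq_mult_powr[of "a + b" \<alpha>] by (simp add: distrib_right)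
  finally show ?thesis .
qed

text \<open>Mean value theorem: the derivative at an intermediate point is at most the derivative at
  \<open>a + b\<close>.\<close>

lemma powr_increment_le:
  fixes a b :: real
  assumes "1 < \<alpha>" "0 \<le> a" "0 \<le> b"
  shows "(a + b) powr \<alpha> - a powr \<alpha> \<le> \<alpha> * b * (a + b) powr (\<alpha> - 1)"
\<comment> \<open>The derivative of \<open>powr\<close> is taken at positive points and the interval
  must be nondegenerate, so the zero cases are settled directly.\<close>
proof (cases "a = 0 \<or> b = 0")
  case True
  then show ?thesis
  proof
    assume "a = 0"
    have "1 * (b * b powr (\<alpha> - 1)) \<le> \<alpha> * (b * b powr (\<alpha> - 1))"
      using assms by (intro mult_right_mono) auto
    then show ?thesis
      using assms \<open>a = 0\<close> powr_eq_mult_powr[of b \<alpha>] by (simp add: mult.assoc)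
  qed simp
next
  case False
  then have pos: "0 < a" "0 < b" using assms by auto
  have "\<exists>z. a < z \<and> z < a + b \<and>
      (a + b) powr \<alpha> - a powr \<alpha> = (a + b - a) * (\<alpha> * z powr (\<alpha> - 1))"
    using pos by (intro MVT2) (auto intro!: derivative_eq_intros)
  then obtain z where z: "a < z" "z < a + b"
    "(a + b) powr \<alpha> - a powr \<alpha> = b * (\<alpha> * z powr (\<alpha> - 1))" by auto
  have "z powr (\<alpha> - 1) \<le> (a + b) powr (\<alpha> - 1)"
    using z pos assms by (intro powr_mono2) auto
  then have "b * (\<alpha> * z powr (\<alpha> - 1)) \<le> b * (\<alpha> * (a + b) powr (\<alpha> - 1))"
    using pos assms by (intro mult_left_mono) auto
  then show ?thesis using z(3) by (simp add: mult_ac)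
qed

text \<open>Two regimes: for \<open>b \<le> d * a\<close> with small \<open>d\<close> the left side
  is a small multiple of \<open>a powr \<alpha>\<close>; otherwise \<open>a + b\<close> is at most a
  constant times \<open>b\<close>.\<close>

lemma powr_young:
  fixes \<alpha> :: real
  assumes "1 < \<alpha>"
  obtains l where "0 < l"
    "\<And>a b. 0 \<le> a \<Longrightarrow> 0 \<le> b \<Longrightarrow> \<alpha> * b * (a + b) powr (\<alpha> - 1) \<le> l * b powr \<alpha> + a powr \<alpha> / 4"
proof -
  \<comment> \<open>This \<open>d\<close> makes the coefficient of \<open>a powr \<alpha>\<close> in
    the first regime exactly 1/4; \<open>d \<le> 1\<close> gives \<open>a + b \<le> 2 * a\<close>
    there.\<close>
  define d where "d = 1 / (4 * \<alpha> * 2 powr (\<alpha> - 1))"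
  have p2: "1 \<le> 2 powr (\<alpha> - 1)" using assms by (simp add: ge_one_powr_ge_zero)
  have "1 \<le> 4 * \<alpha> * 2 powr (\<alpha> - 1)"
    using mult_mono[of 1 "4 * \<alpha>" 1 "2 powr (\<alpha> - 1)"] p2 assms by simp
  then have d: "0 < d" "d \<le> 1" unfolding d_def using assms by (auto simp: field_simps)
  have dd: "\<alpha> * d * 2 powr (\<alpha> - 1) = 1 / 4" unfolding d_def using assms by (simp add: field_simps)
  define l where "l = \<alpha> * (1 / d + 1) powr (\<alpha> - 1)"
  have l: "0 < l" unfolding l_def using assms d by (intro mult_pos_pos) (auto simp: add_pos_pos less_imp_neq[symmetric])
  show thesis
  proof (rule that[OF l])
    fix a b :: real
    assume ab: "0 \<le> a" "0 \<le> b"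
    show "\<alpha> * b * (a + b) powr (\<alpha> - 1) \<le> l * b powr \<alpha> + a powr \<alpha> / 4"
    proof (cases "b \<le> d * a")
      case True
      have "d * a \<le> 1 * a" using d ab by (intro mult_right_mono) auto
      then have "a + b \<le> 2 * a" using True by simp
      then have "(a + b) powr (\<alpha> - 1) \<le> (2 * a) powr (\<alpha> - 1)"
        using ab assms by (intro powr_mono2) auto
      then have "\<alpha> * b * (a + b) powr (\<alpha> - 1) \<le> \<alpha> * (d * a) * (2 * a) powr (\<alpha> - 1)"
        using True ab assms d by (intro mult_mono) auto
      also have "\<dots> = (\<alpha> * d * 2 powr (\<alpha> - 1)) * (a * a powr (\<alpha> - 1))"
        using ab by (simp add: powr_mult)
      also have "\<dots> = a powr \<alpha> / 4"
        unfolding dd using powr_eq_mult_powr[of a \<alpha>] ab by simp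
      finally show ?thesis using l by (smt (verit) mult_nonneg_nonneg powr_ge_zero)
    next
      case False
      then have "a \<le> b / d" using d by (simp add: field_simps)
      then have "a + b \<le> (1 / d + 1) * b" by (simp add: distrib_right)
      then have "(a + b) powr (\<alpha> - 1) \<le> ((1 / d + 1) * b) powr (\<alpha> - 1)"
        using ab assms by (intro powr_mono2) auto
      then have "\<alpha> * b * (a + b) powr (\<alpha> - 1) \<le> \<alpha> * b * ((1 / d + 1) * b) powr (\<alpha> - 1)"
        using ab assms by (intro mult_left_mono) auto
      also have "\<dots> = l * (b * b powr (\<alpha> - 1))"
        unfolding l_def using ab d by (subst powr_mult) auto
      also have "\<dots> = l * b powr \<alpha>" using powr_eq_mult_powr[of b \<alpha>] ab by simp
      finally show ?thesis by (rule order_trans) simp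
    qed
  qed
qed

section \<open>Loads and their energy\<close>

text \<open>Counterpart of \<open>job_speed\<close> for a run that is never interrupted, so that a
  schedule without rejections becomes a plain map from jobs to runs.\<close>

definition run_speed :: "sched_instance \<Rightarrow> nat \<Rightarrow> run \<Rightarrow> nat \<Rightarrow> real \<Rightarrow> real" where
  "run_speed I j x i t =
     (if machine x = i \<and> start x \<le> t \<and> t < completion I j x then speed x else 0)"

definition load :: "sched_instance \<Rightarrow> (nat \<Rightarrow> run) \<Rightarrow> nat set \<Rightarrow> nat \<Rightarrow> real \<Rightarrow> real" where
  "load I X K i t = (\<Sum>k\<in>K. run_speed I k (X k) i t)"

definition load_energy ::
  "real \<Rightarrow> nat set \<Rightarrow> sched_instance \<Rightarrow> (nat \<Rightarrow> run) \<Rightarrow> nat set \<Rightarrow> real" where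
  "load_energy \<alpha> M I X K = (\<Sum>i\<in>M. LBINT t:{0..}. load I X K i t powr \<alpha>)"

section \<open>Nonnegativity, monotonicity and integrability of loads\<close>

lemma run_speed_nonneg: "valid_run M I j x \<Longrightarrow> 0 \<le> run_speed I j x i t"
  by (auto simp: run_speed_def valid_run_def)

lemma load_nonneg: "(\<And>k. k \<in> K \<Longrightarrow> valid_run M I k (X k)) \<Longrightarrow> 0 \<le> load I X K i t"
  unfolding load_def by (intro sum_nonneg run_speed_nonneg) auto

lemma load_mono:
  assumes "finite L" "K \<subseteq> L" "\<And>k. k \<in> L \<Longrightarrow> valid_run M I k (X k)"
  shows "load I X K i t \<le> load I X L i t"
  unfolding load_def using assms by (intro sum_mono2) (auto intro: run_speed_nonneg)

lemma load_insert:
  "finite K \<Longrightarrow> j \<notin> K \<Longrightarrow> load I X (insert j K) i t = load I X K i t + run_speed I j (X j) i t"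
  unfolding load_def by simp

lemma load_cong:
  "(\<And>k. k \<in> K \<Longrightarrow> X k = Y k) \<Longrightarrow> load I X K i t = load I Y K i t"
  unfolding load_def by (intro sum.cong) auto

lemma load_fun_upd: "j \<notin> K \<Longrightarrow> load I (X(j := x)) K i t = load I X K i t"
  by (rule load_cong) auto

lemma run_speed_measurable [measurable]: "run_speed I j x i \<in> borel_measurable borel"
  unfolding run_speed_def by measurable

lemma load_measurable [measurable]: "load I X K i \<in> borel_measurable borel"
  unfolding load_def by measurable

text \<open>The load is bounded by the sum of all speeds and vanishes after a finite time, so a
  constant on a bounded interval dominates the integrand.\<close>

lemma load_powr_integrable:
  assumes "finite K" "\<And>k. k \<in> K \<Longrightarrow> valid_run M I k (X k)" "0 \<le> \<alpha>"
  shows "set_integrable lborel {0..} (\<lambda>t. load I X K i t powr \<alpha>)"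
proof -
  define T where "T = (\<Sum>k\<in>K. \<bar>completion I k (X k)\<bar>)"
  define B where "B = (\<Sum>k\<in>K. speed (X k))"
  have B: "load I X K i t \<le> B" for t
    unfolding load_def B_def
    by (intro sum_mono) (use assms(2) in \<open>auto simp: run_speed_def valid_run_def intro: less_imp_le\<close>)
  have z: "load I X K i t = 0" if "T < t" for t
  proof -
    have "completion I k (X k) \<le> T" if "k \<in> K" for k
      unfolding T_def using assms(1) that
      by (smt (verit) abs_ge_zero member_le_sum)
    then show ?thesis unfolding load_def run_speed_def using that
      by (intro sum.neutral) fastforce
  qed
  have nn: "0 \<le> load I X K i t" for t by (rule load_nonneg[OF assms(2)])
  show ?thesis unfolding set_integrable_def
  proof (rule Bochner_Integration.integrable_bound[where f = "\<lambda>t. indicator {0..T} t * B powr \<alpha>"])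
    show "integrable lborel (\<lambda>t. indicator {0..T} t * B powr \<alpha>)"
      by (intro integrable_mult_left integrable_real_indicator) (auto simp: emeasure_lborel_Icc_eq)
    show "AE t in lborel. norm (indicat_real {0..} t *\<^sub>R load I X K i t powr \<alpha>)
        \<le> norm (indicator {0..T} t * B powr \<alpha>)"
      using B z nn assms(3)
      by (intro AE_I2) (auto simp: indicator_def intro!: powr_mono2)
  qed measurable
qed

lemma load_energy_nonneg: "0 \<le> load_energy \<alpha> M I X K"
  unfolding load_energy_def set_lebesgue_integral_def
  by (intro sum_nonneg integral_nonneg_AE) auto

text \<open>Energy increments become integrals of pointwise increments, to which inequalities
  between powers apply.\<close>

lemma load_energy_insert:
  assumes "finite K" "j \<notin> K" "\<And>k. k \<in> K \<Longrightarrow> valid_run M I k (X k)" "valid_run M I j x" "0 \<le> \<alpha>"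
  shows "load_energy \<alpha> M I (X(j := x)) (insert j K) - load_energy \<alpha> M I X K =
      (\<Sum>i\<in>M. LBINT t:{0..}. (load I X K i t + run_speed I j x i t) powr \<alpha> - load I X K i t powr \<alpha>)"
    and "set_integrable lborel {0..}
      (\<lambda>t. (load I X K i t + run_speed I j x i t) powr \<alpha> - load I X K i t powr \<alpha>)"
proof -
  have eq: "load I (X(j := x)) (insert j K) i t = load I X K i t + run_speed I j x i t" for i t
    using assms by (simp add: load_insert load_fun_upd)
  have int: "set_integrable lborel {0..} (\<lambda>t. (load I X K i t + run_speed I j x i t) powr \<alpha>)" for i
    unfolding eq[symmetric] using assms by (intro load_powr_integrable[where M = M]) auto
  have int': "set_integrable lborel {0..} (\<lambda>t. load I X K i t powr \<alpha>)" for i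
    using assms by (intro load_powr_integrable[where M = M]) auto
  show "set_integrable lborel {0..}
      (\<lambda>t. (load I X K i t + run_speed I j x i t) powr \<alpha> - load I X K i t powr \<alpha>)"
    by (intro set_integral_diff int int')
  show "load_energy \<alpha> M I (X(j := x)) (insert j K) - load_energy \<alpha> M I X K =
      (\<Sum>i\<in>M. LBINT t:{0..}. (load I X K i t + run_speed I j x i t) powr \<alpha> - load I X K i t powr \<alpha>)"
    unfolding load_energy_def eq sum_subtractf[symmetric]
    by (intro sum.cong refl) (simp add: set_integral_diff(2) int int')
qed

lemma completion_gt_start:
  assumes "valid_instance M I" "j \<in> jobs I" "valid_run M I j x"
  shows "start x < completion I j x" "0 \<le> start x"
  using assms by (force simp: valid_instance_def valid_run_def completion_def)+

text \<open>Only the term of the run's own machine is kept; there the power is constant on the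
  execution interval, which lies in \<open>{0..}\<close>.\<close>

lemma run_energy:
  assumes "valid_instance M I" "j \<in> jobs I" "valid_run M I j x" "finite M"
  shows "speed x powr \<alpha> * (volume I (machine x) j / speed x) \<le>
      (\<Sum>i\<in>M. LBINT t:{0..}. run_speed I j x i t powr \<alpha>)"
proof -
  have c: "start x < completion I j x" "0 \<le> start x" using completion_gt_start assms by auto
  have "(LBINT t:{0..}. run_speed I j x (machine x) t powr \<alpha>) =
      (LBINT t. indicator {start x..<completion I j x} t * speed x powr \<alpha>)"
    unfolding set_lebesgue_integral_def using c
    by (intro Bochner_Integration.integral_cong refl) (auto simp: run_speed_def indicator_def)
  also have "\<dots> = speed x powr \<alpha> * (volume I (machine x) j / speed x)"
    using c by (simp add: completion_def)
  finally have eq: "speed x powr \<alpha> * (volume I (machine x) j / speed x) =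
      (LBINT t:{0..}. run_speed I j x (machine x) t powr \<alpha>)" ..
  show ?thesis unfolding eq using assms
    by (intro member_le_sum) (auto simp: valid_run_def set_lebesgue_integral_def
        intro!: integral_nonneg_AE)
qed

section \<open>The greedy algorithm\<close>

text \<open>Ties among simultaneous releases are broken by the name of the job.\<close>

definition before :: "sched_instance \<Rightarrow> nat \<Rightarrow> nat \<Rightarrow> bool" where
  "before I k j \<longleftrightarrow> release I k < release I j \<or> release I k = release I j \<and> k < j"

definition earlier :: "sched_instance \<Rightarrow> nat \<Rightarrow> nat set" where
  "earlier I j = {k \<in> jobs I. before I k j}"

text \<open>The increase of the objective when \<open>j\<close> is added with run \<open>x\<close>
  on top of the earlier jobs; only the runs that \<open>X\<close> gives to those jobs enter.\<close>

definition marginal ::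
  "real \<Rightarrow> nat set \<Rightarrow> sched_instance \<Rightarrow> (nat \<Rightarrow> run) \<Rightarrow> nat \<Rightarrow> run \<Rightarrow> real" where
  "marginal \<alpha> M I X j x =
     weight I j * (completion I j x - release I j) +
     (load_energy \<alpha> M I (X(j := x)) (insert j (earlier I j)) - load_energy \<alpha> M I X (earlier I j))"

definition nearly_best ::
  "real \<Rightarrow> nat set \<Rightarrow> sched_instance \<Rightarrow> (nat \<Rightarrow> run) \<Rightarrow> nat \<Rightarrow> run \<Rightarrow> bool" where
  "nearly_best \<alpha> M I X j x \<longleftrightarrow> valid_run M I j x \<and>
     (\<forall>y. valid_run M I j y \<longrightarrow> marginal \<alpha> M I X j x \<le> 2 * marginal \<alpha> M I X j y)"

lemma earlier_trans: "k \<in> earlier I j \<Longrightarrow> earlier I k \<subseteq> earlier I j"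
  unfolding earlier_def before_def by auto

lemma not_in_earlier: "j \<notin> earlier I j"
  unfolding earlier_def before_def by simp

text \<open>The guard shows the termination proof that recursive calls concern earlier jobs only.
  For a finite job set the value \<open>undefined\<close> elsewhere is harmless, as
  \<open>nearly_best\<close> reads just the runs of earlier jobs.\<close>

function greedy :: "real \<Rightarrow> nat set \<Rightarrow> sched_instance \<Rightarrow> nat \<Rightarrow> run" where
  "greedy \<alpha> M I j = (SOME x. nearly_best \<alpha> M I
     (\<lambda>k. if finite (jobs I) \<and> k \<in> earlier I j then greedy \<alpha> M I k else undefined) j x)"
  by auto
termination
proof (relation "inv_image less_than (\<lambda>(\<alpha>, M, I, j). card (earlier I j))")
  fix \<alpha> :: real and M I j k x
  assume k: "finite (jobs I) \<and> k \<in> earlier I j"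
  then have "earlier I k \<subset> earlier I j"
    using earlier_trans not_in_earlier by blast
  moreover have "finite (earlier I j)" using k by (simp add: earlier_def)
  ultimately show "((\<alpha>, M, I, k), \<alpha>, M, I, j) \<in> inv_image less_than (\<lambda>(\<alpha>, M, I, j). card (earlier I j))"
    by (simp add: psubset_card_mono)
qed simp

declare greedy.simps [simp del]

section \<open>Existence of nearly best runs\<close>

lemma marginal_cong:
  assumes "\<And>k. k \<in> earlier I j \<Longrightarrow> X k = Y k"
  shows "marginal \<alpha> M I X j x = marginal \<alpha> M I Y j x"
proof -
  have "load I (X(j := x)) (insert j (earlier I j)) i t = load I (Y(j := x)) (insert j (earlier I j)) i t"
    "load I X (earlier I j) i t = load I Y (earlier I j) i t" for i t
    using assms by (auto intro!: load_cong)
  then show ?thesis unfolding marginal_def load_energy_def by simp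
qed

lemma nearly_best_cong:
  "(\<And>k. k \<in> earlier I j \<Longrightarrow> X k = Y k) \<Longrightarrow> nearly_best \<alpha> M I X j x = nearly_best \<alpha> M I Y j x"
  unfolding nearly_best_def using marginal_cong by metis

text \<open>Slow runs pay in flow time, fast runs in energy: with speed \<open>s\<close> and volume
  \<open>p\<close> the two parts are at least \<open>weight I j * (p / s)\<close> and
  \<open>s powr (\<alpha> - 1) * p\<close>. The resulting bound does not depend on start and
  speed.\<close>

lemma marginal_lower_bound:
  assumes "1 < \<alpha>" "finite M" and I: "valid_instance M I" and j: "j \<in> jobs I"
    and X: "\<And>k. k \<in> earlier I j \<Longrightarrow> valid_run M I k (X k)" and x: "valid_run M I j x"
  shows "min (weight I j) 1 * volume I (machine x) j \<le> marginal \<alpha> M I X j x"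
proof -
  define s p where "s = speed x" and "p = volume I (machine x) j"
  have sp: "0 < s" "0 < p" "0 < weight I j"
    using I j x by (auto simp: s_def p_def valid_run_def valid_instance_def)
  have fin: "finite (earlier I j)" using I by (simp add: earlier_def valid_instance_def)
  note ins = load_energy_insert[OF fin not_in_earlier X x, of \<alpha>]
  have "set_integrable lborel {0..} (\<lambda>t. load I (\<lambda>_. x) {j} i t powr \<alpha>)" for i
    using assms by (intro load_powr_integrable[where M = M]) auto
  then have int: "set_integrable lborel {0..} (\<lambda>t. run_speed I j x i t powr \<alpha>)" for i
    by (simp add: load_def)
  have "s powr \<alpha> * (p / s) \<le> (\<Sum>i\<in>M. LBINT t:{0..}. run_speed I j x i t powr \<alpha>)"
    unfolding s_def p_def by (rule run_energy[OF I j x assms(2)])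
  \<comment> \<open>Superadditivity: on top of an existing load the run increases the energy by at
    least what it uses alone.\<close>
  also have "\<dots> \<le> (\<Sum>i\<in>M. LBINT t:{0..}.
      (load I X (earlier I j) i t + run_speed I j x i t) powr \<alpha> - load I X (earlier I j) i t powr \<alpha>)"
  proof (intro sum_mono set_integral_mono int)
    fix i t
    have "load I X (earlier I j) i t powr \<alpha> + run_speed I j x i t powr \<alpha> \<le>
        (load I X (earlier I j) i t + run_speed I j x i t) powr \<alpha>"
      using assms by (intro powr_superadditive load_nonneg[OF X] run_speed_nonneg[OF x]) auto
    then show "run_speed I j x i t powr \<alpha> \<le>
        (load I X (earlier I j) i t + run_speed I j x i t) powr \<alpha> - load I X (earlier I j) i t powr \<alpha>"
      by simp
  qed (use ins(2) assms in auto)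
  finally have E: "s powr \<alpha> * (p / s) \<le>
      load_energy \<alpha> M I (X(j := x)) (insert j (earlier I j)) - load_energy \<alpha> M I X (earlier I j)"
    using ins(1) assms by simp
  have "weight I j * (p / s) \<le> weight I j * (completion I j x - release I j)"
    using sp x by (intro mult_left_mono) (auto simp: completion_def s_def p_def valid_run_def)
  then have le: "weight I j * (p / s) + s powr \<alpha> * (p / s) \<le> marginal \<alpha> M I X j x"
    using E unfolding marginal_def by simp
  show ?thesis
  proof (cases "s \<le> 1")
    case True
    then have "p \<le> p / s" using sp by (simp add: field_simps)
    then have "min (weight I j) 1 * p \<le> weight I j * (p / s)"
      using sp by (intro mult_mono) auto
    moreover have "0 \<le> s powr \<alpha> * (p / s)" using sp by simp
    ultimately show ?thesis using le unfolding p_def by linarith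
  next
    case False
    have "min (weight I j) 1 * p \<le> 1 * p" using sp by (intro mult_right_mono) auto
    also have "\<dots> \<le> s powr (\<alpha> - 1) * p"
      using False assms sp by (intro mult_right_mono) (auto simp: ge_one_powr_ge_zero)
    also have "\<dots> = s powr \<alpha> * (p / s)" using sp by (simp add: powr_diff)
    finally have "min (weight I j) 1 * p \<le> s powr \<alpha> * (p / s)" .
    moreover have "0 \<le> weight I j * (p / s)" using sp by simp
    ultimately show ?thesis using le unfolding p_def by linarith
  qed
qed

text \<open>The infimum \<open>m\<close> is at least \<open>c > 0\<close>, so \<open>2 * m\<close>
  lies strictly above it and is undercut by some value.\<close>

lemma nearly_minimal_ex:
  fixes f :: "'a \<Rightarrow> real"
  assumes "P x0" "0 < c" "\<And>x. P x \<Longrightarrow> c \<le> f x"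
  shows "\<exists>x. P x \<and> (\<forall>y. P y \<longrightarrow> f x \<le> 2 * f y)"
proof -
  define m where "m = Inf (f ` Collect P)"
  have bdd: "bdd_below (f ` Collect P)" using assms(3) by (auto simp: bdd_below_def)
  have "c \<le> m" unfolding m_def using assms by (intro cInf_greatest) auto
  then have "m < 2 * m" using assms(2) by simp
  then obtain x where "P x" "f x < 2 * m"
    using cInf_less_iff[OF _ bdd, of "2 * m"] assms(1) unfolding m_def by auto
  moreover have "m \<le> f y" if "P y" for y
    unfolding m_def using that bdd by (intro cInf_lower) auto
  ultimately show ?thesis by (intro exI[of _ x]) fastforce
qed

lemma nearly_best_ex:
  assumes "1 < \<alpha>" "finite M" "M \<noteq> {}" and I: "valid_instance M I" and j: "j \<in> jobs I"
    and X: "\<And>k. k \<in> earlier I j \<Longrightarrow> valid_run M I k (X k)"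
  shows "\<exists>x. nearly_best \<alpha> M I X j x"
proof -
  obtain i where i: "i \<in> M" using assms(3) by auto
  \<comment> \<open>The minimum over the finitely many machines makes the lower bound independent of
    the machine as well.\<close>
  define v where "v = Min ((\<lambda>i. volume I i j) ` M)"
  have v: "0 < v" "\<And>i. i \<in> M \<Longrightarrow> v \<le> volume I i j"
    unfolding v_def using assms by (auto simp: valid_instance_def)
  have w: "0 < min (weight I j) 1" using I j by (auto simp: valid_instance_def)
  show ?thesis unfolding nearly_best_def
  proof (rule nearly_minimal_ex)
    show "valid_run M I j \<lparr>machine = i, start = release I j, speed = 1\<rparr>"
      using i by (simp add: valid_run_def)
    show "0 < min (weight I j) 1 * v" using v w by simp
    show "min (weight I j) 1 * v \<le> marginal \<alpha> M I X j x" if x: "valid_run M I j x" for x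
    proof -
      have "min (weight I j) 1 * v \<le> min (weight I j) 1 * volume I (machine x) j"
        using w v(2) x by (intro mult_left_mono) (auto simp: valid_run_def)
      also have "\<dots> \<le> marginal \<alpha> M I X j x"
        using assms x by (intro marginal_lower_bound) auto
      finally show ?thesis .
    qed
  qed
qed

section \<open>Specification of the greedy choices\<close>

lemma greedy_eq:
  assumes "finite (jobs I)"
  shows "greedy \<alpha> M I j = (SOME x. nearly_best \<alpha> M I (greedy \<alpha> M I) j x)"
  using assms by (subst greedy.simps) (auto intro!: arg_cong[where f = Eps] nearly_best_cong)

text \<open>Strong induction on the number of earlier jobs. It ranges over all names
  \<open>j\<close>, so its uses carry membership in the job set inside \<open>P\<close>.\<close>

lemma earlier_induct [consumes 1, case_names step]:
  assumes "finite (jobs I)"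
    and "\<And>j. (\<And>k. k \<in> earlier I j \<Longrightarrow> P k) \<Longrightarrow> P j"
  shows "P j"
proof (induction "card (earlier I j)" arbitrary: j rule: less_induct)
  case less
  show ?case
  proof (rule assms(2))
    fix k assume "k \<in> earlier I j"
    moreover from this have "earlier I k \<subset> earlier I j"
      using earlier_trans not_in_earlier by blast
    moreover have "finite (earlier I j)" using assms(1) by (simp add: earlier_def)
    ultimately show "P k" by (intro less) (simp add: psubset_card_mono)
  qed
qed

text \<open>A nearly best run exists once the earlier runs are valid, and these are valid by
  induction; the choice operator then has a witness.\<close>

lemma greedy_nearly_best:
  assumes "1 < \<alpha>" "finite M" "M \<noteq> {}" and I: "valid_instance M I" and "j \<in> jobs I"
  shows "nearly_best \<alpha> M I (greedy \<alpha> M I) j (greedy \<alpha> M I j)"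
proof -
  have fin: "finite (jobs I)" using I by (simp add: valid_instance_def)
  have "j \<in> jobs I \<longrightarrow> nearly_best \<alpha> M I (greedy \<alpha> M I) j (greedy \<alpha> M I j)" for j
    using fin
  proof (induction j rule: earlier_induct)
    case (step j)
    show ?case
    proof
      assume "j \<in> jobs I"
      then have "\<exists>x. nearly_best \<alpha> M I (greedy \<alpha> M I) j x"
        using assms step by (intro nearly_best_ex) (auto simp: nearly_best_def earlier_def)
      then show "nearly_best \<alpha> M I (greedy \<alpha> M I) j (greedy \<alpha> M I j)"
        unfolding greedy_eq[OF fin, of \<alpha> M j] by (rule someI_ex)
    qed
  qed
  then show ?thesis using assms by simp
qed

lemma greedy_valid:
  assumes "1 < \<alpha>" "finite M" "M \<noteq> {}" "valid_instance M I" "j \<in> jobs I"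
  shows "valid_run M I j (greedy \<alpha> M I j)"
  using greedy_nearly_best[OF assms] by (simp add: nearly_best_def)

section \<open>Non-anticipation\<close>

lemma agree_until_earlier:
  assumes "agree_until M t I I'" "j \<in> released_by t I"
  shows "earlier I j = earlier I' j" "earlier I j \<subseteq> released_by t I"
proof -
  have rel: "released_by t I = released_by t I'"
    "\<And>k. k \<in> released_by t I \<Longrightarrow> release I k = release I' k"
    using assms(1) by (auto simp: agree_until_def)
  have *: "earlier I j = {k \<in> released_by t I. before I k j}"
    using assms(2) by (auto simp: earlier_def released_by_def before_def)
  have **: "earlier I' j = {k \<in> released_by t I'. before I' k j}"
    using assms(2) unfolding rel(1) by (auto simp: earlier_def released_by_def before_def)
  show "earlier I j = earlier I' j" unfolding * ** before_def using rel assms(2) by auto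
  show "earlier I j \<subseteq> released_by t I" unfolding * by auto
qed

lemma agree_until_completion:
  assumes "agree_until M t I I'" "j \<in> released_by t I" "machine x \<in> M"
  shows "completion I j x = completion I' j x"
  using assms by (auto simp: agree_until_def completion_def)

lemma agree_until_load:
  assumes "agree_until M t I I'" "K \<subseteq> released_by t I" "\<And>k. k \<in> K \<Longrightarrow> machine (X k) \<in> M"
  shows "load I X K i u = load I' X K i u"
  unfolding load_def run_speed_def using assms
  by (intro sum.cong refl) (auto simp: agree_until_completion[OF assms(1)] subset_iff)

lemma agree_until_valid_run:
  assumes "agree_until M t I I'" "j \<in> released_by t I"
  shows "valid_run M I j x = valid_run M I' j x"
  using assms by (auto simp: agree_until_def valid_run_def)

text \<open>\<open>agree_until\<close> compares volumes on machines in \<open>M\<close> only, hence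
  the restrictions on the machines of the runs.\<close>

lemma agree_until_marginal:
  assumes agree: "agree_until M t I I'" and j: "j \<in> released_by t I"
    and X: "\<And>k. k \<in> earlier I j \<Longrightarrow> machine (X k) \<in> M" and x: "machine x \<in> M"
  shows "marginal \<alpha> M I X j x = marginal \<alpha> M I' X j x"
proof -
  note e = agree_until_earlier[OF agree j]
  have "load I X (earlier I j) i u = load I' X (earlier I j) i u" for i u
    using X e(2) by (intro agree_until_load[OF agree]) auto
  moreover have "load I (X(j := x)) (insert j (earlier I j)) i u =
      load I' (X(j := x)) (insert j (earlier I j)) i u" for i u
    using X x e(2) j by (intro agree_until_load[OF agree]) auto
  moreover have "weight I j = weight I' j" "release I j = release I' j"
    using agree j by (auto simp: agree_until_def)
  ultimately show ?thesis
    unfolding marginal_def load_energy_def e(1)[symmetric]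
    by (simp add: agree_until_completion[OF agree j x])
qed

text \<open>By induction over earlier jobs both instances yield the same predicate
  \<open>nearly_best\<close>, and \<open>SOME\<close> returns equal values for equal
  predicates.\<close>

lemma greedy_non_anticipating:
  assumes \<alpha>: "1 < \<alpha>" and M: "finite M" "M \<noteq> {}"
    and I: "valid_instance M I" and I': "valid_instance M I'"
    and agree: "agree_until M t I I'" and "j \<in> released_by t I"
  shows "greedy \<alpha> M I j = greedy \<alpha> M I' j"
proof -
  have fin: "finite (jobs I)" "finite (jobs I')" using I I' by (simp_all add: valid_instance_def)
  have "j \<in> released_by t I \<longrightarrow> greedy \<alpha> M I j = greedy \<alpha> M I' j" for j
    using fin(1)
  proof (induction j rule: earlier_induct)
    case (step j)
    show ?case
    proof
      assume j: "j \<in> released_by t I"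
      note e = agree_until_earlier[OF agree j]
      have eq: "greedy \<alpha> M I k = greedy \<alpha> M I' k" if "k \<in> earlier I j" for k
        using step that e(2) by blast
      have "machine (greedy \<alpha> M I k) \<in> M" if "k \<in> earlier I j" for k
        using greedy_valid[OF \<alpha> M I, of k] that by (simp add: earlier_def valid_run_def)
      then have "marginal \<alpha> M I (greedy \<alpha> M I) j x = marginal \<alpha> M I' (greedy \<alpha> M I) j x"
        if "machine x \<in> M" for x
        using that by (intro agree_until_marginal[OF agree j]) auto
      \<comment> \<open>At invalid runs both predicates are false, so equality of the marginal costs
        on machines in \<open>M\<close> suffices.\<close>
      then have "nearly_best \<alpha> M I (greedy \<alpha> M I) j = nearly_best \<alpha> M I' (greedy \<alpha> M I) j"
        unfolding nearly_best_def agree_until_valid_run[OF agree j]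
        by (auto simp: valid_run_def fun_eq_iff)
      also have "\<dots> = nearly_best \<alpha> M I' (greedy \<alpha> M I') j"
        using eq unfolding e(1) by (intro ext nearly_best_cong) auto
      finally show "greedy \<alpha> M I j = greedy \<alpha> M I' j"
        unfolding greedy_eq[OF fin(1), of \<alpha> M j] greedy_eq[OF fin(2), of \<alpha> M j] by simp
    qed
  qed
  then show ?thesis using assms by simp
qed

section \<open>Competitiveness\<close>

definition assignment_cost ::
  "real \<Rightarrow> nat set \<Rightarrow> sched_instance \<Rightarrow> (nat \<Rightarrow> run) \<Rightarrow> real" where
  "assignment_cost \<alpha> M I X =
     (\<Sum>j\<in>jobs I. weight I j * (completion I j (X j) - release I j)) + load_energy \<alpha> M I X (jobs I)"

text \<open>Without rejection, feasibility forces a valid run for every job, and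
  \<open>stop_time\<close> is its completion time.\<close>

lemma cost_no_rejection:
  assumes "feasible M I S" "rejected I S = {}"
  shows "cost \<alpha> M I S = assignment_cost \<alpha> M I (\<lambda>j. the (run_of S j))"
    and "\<And>j. j \<in> jobs I \<Longrightarrow> valid_run M I j (the (run_of S j))"
proof -
  have rej: "reject_at S j = None" if "j \<in> jobs I" for j
    using assms(2) that by (auto simp: rejected_def)
  have run: "\<exists>x. run_of S j = Some x \<and> valid_run M I j x" if "j \<in> jobs I" for j
    using assms(1) that rej[OF that] by (auto simp: feasible_def split: option.splits)
  show "\<And>j. j \<in> jobs I \<Longrightarrow> valid_run M I j (the (run_of S j))" using run by fastforce
  have "job_speed I S i j t = run_speed I j (the (run_of S j)) i t" if "j \<in> jobs I" for i j t
    using run[OF that] rej[OF that] by (auto simp: job_speed_def run_speed_def stop_time_def)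
  then have "machine_speed I S i t = load I (\<lambda>j. the (run_of S j)) (jobs I) i t" for i t
    unfolding machine_speed_def load_def by (intro sum.cong) auto
  then show "cost \<alpha> M I S = assignment_cost \<alpha> M I (\<lambda>j. the (run_of S j))"
    unfolding cost_def assignment_cost_def energy_def load_energy_def flow_time_def assms(2) by simp
qed

text \<open>Telescoping along a strict linear order: the predecessors of the greatest element
  \<open>m\<close> are all the rest, and removing \<open>m\<close> changes no other set of
  predecessors.\<close>

lemma sum_increments:
  fixes E :: "'a set \<Rightarrow> real"
  assumes "finite K" "asymp R" "transp R" "totalp R"
  shows "(\<Sum>j\<in>K. E (insert j {k \<in> K. R k j}) - E {k \<in> K. R k j}) = E K - E {}"
  using assms(1)
proof (induction K rule: finite_psubset_induct)
  case (psubset K)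
  show ?case
  proof (cases "K = {}")
    case False
    have "asymp_on K R" "transp_on K R"
      using assms(2,3) by (auto intro: asymp_on_subset transp_on_subset)
    then obtain m where m: "m \<in> K" "\<forall>k\<in>K. k \<noteq> m \<longrightarrow> \<not> R m k"
      using Finite_Set.bex_max_element[OF psubset.hyps _ _ False] by blast
    define S where "S = K - {m}"
    have K: "K = insert m S" "m \<notin> S" "finite S" using m psubset.hyps by (auto simp: S_def)
    have irrefl: "\<not> R m m" using assms(2) by (auto dest: asympD)
    have R: "R k m" if "k \<in> S" for k
      using that m(2) assms(4) unfolding S_def by (metis DiffE insertI1 totalpD)
    have m': "{k \<in> K. R k m} = S" using R irrefl K by auto
    have S': "{k \<in> K. R k j} = {k \<in> S. R k j}" if "j \<in> S" for j
      using m that unfolding S_def by auto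
    have IH: "(\<Sum>j\<in>S. E (insert j {k \<in> S. R k j}) - E {k \<in> S. R k j}) = E S - E {}"
      using psubset.IH[of S] K by blast
    have "(\<Sum>j\<in>K. E (insert j {k \<in> K. R k j}) - E {k \<in> K. R k j}) =
        (E K - E S) + (\<Sum>j\<in>S. E (insert j {k \<in> K. R k j}) - E {k \<in> K. R k j})"
      using sum.insert[OF K(3,2), of "\<lambda>j. E (insert j {k \<in> K. R k j}) - E {k \<in> K. R k j}"]
      unfolding m' K(1)[symmetric] .
    also have "\<dots> = (E K - E S) + (E S - E {})"
      unfolding IH[symmetric] using S' by (simp cong: sum.cong)
    finally show ?thesis by simp
  qed simp
qed

lemma assignment_cost_eq_marginals:
  assumes "finite (jobs I)"
  shows "assignment_cost \<alpha> M I X = (\<Sum>j\<in>jobs I. marginal \<alpha> M I X j (X j))"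
proof -
  have "(\<Sum>j\<in>jobs I. load_energy \<alpha> M I X (insert j (earlier I j)) - load_energy \<alpha> M I X (earlier I j)) =
      load_energy \<alpha> M I X (jobs I) - load_energy \<alpha> M I X {}"
    unfolding earlier_def using assms 
    by (intro sum_increments) (auto simp: before_def intro!: asympI transpI totalpI)
  \<comment> \<open>As \<open>0 powr \<alpha> = 0\<close>, idle machines use no energy.\<close>
  also have "load_energy \<alpha> M I X {} = 0"
    by (simp add: load_energy_def load_def)
  finally show ?thesis
    unfolding assignment_cost_def marginal_def by (simp add: sum.distrib)
qed

text \<open>Each run of \<open>Y\<close> is tested against a partial load of \<open>X\<close>. At
  every machine and time, an increment is at most
  \<open>\<alpha> * b j i t * (A + B) powr (\<alpha> - 1)\<close> with the full loads
  \<open>A\<close> and \<open>B\<close>; the speeds \<open>b j i t\<close> add up to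
  \<open>B\<close>, and the hypothesis on \<open>l\<close> splits the result.\<close>

lemma marginal_sum_le:
  assumes \<alpha>: "1 < \<alpha>" and M: "finite M" and fin: "finite (jobs I)"
    and X: "\<And>j. j \<in> jobs I \<Longrightarrow> valid_run M I j (X j)"
    and Y: "\<And>j. j \<in> jobs I \<Longrightarrow> valid_run M I j (Y j)"
    and l: "\<And>a b. 0 \<le> a \<Longrightarrow> 0 \<le> b \<Longrightarrow> \<alpha> * b * (a + b) powr (\<alpha> - 1) \<le> l * b powr \<alpha> + a powr \<alpha> / 4"
  shows "(\<Sum>j\<in>jobs I. marginal \<alpha> M I X j (Y j)) \<le>
    (\<Sum>j\<in>jobs I. weight I j * (completion I j (Y j) - release I j)) +
    l * load_energy \<alpha> M I Y (jobs I) + load_energy \<alpha> M I X (jobs I) / 4"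
proof -
  let ?J = "jobs I"
  define a where "a j i t = load I X (earlier I j) i t" for j i t
  define b where "b j i t = run_speed I j (Y j) i t" for j i t
  have sub: "earlier I j \<subseteq> ?J" for j by (auto simp: earlier_def)
  have fe: "finite (earlier I j)" for j using sub fin finite_subset by blast
  have ins: "load_energy \<alpha> M I (X(j := Y j)) (insert j (earlier I j)) - load_energy \<alpha> M I X (earlier I j) =
      (\<Sum>i\<in>M. LBINT t:{0..}. (a j i t + b j i t) powr \<alpha> - a j i t powr \<alpha>)"
    and int: "set_integrable lborel {0..} (\<lambda>t. (a j i t + b j i t) powr \<alpha> - a j i t powr \<alpha>)"
    if "j \<in> ?J" for j i
    unfolding a_def b_def
    using load_energy_insert[OF fe not_in_earlier _ Y[OF that], of X \<alpha>] X sub \<alpha> by (auto simp: subset_iff)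
  have iX: "set_integrable lborel {0..} (\<lambda>t. load I X ?J i t powr \<alpha>)"
    and iY: "set_integrable lborel {0..} (\<lambda>t. load I Y ?J i t powr \<alpha>)" for i
    using X Y fin \<alpha> by (auto intro!: load_powr_integrable[where M = M])
  have pw: "(\<Sum>j\<in>?J. (a j i t + b j i t) powr \<alpha> - a j i t powr \<alpha>) \<le>
      l * load I Y ?J i t powr \<alpha> + load I X ?J i t powr \<alpha> / 4" for i t
  proof -
    define A B where "A = load I X ?J i t" and "B = load I Y ?J i t"
    have AB: "0 \<le> A" "0 \<le> B" unfolding A_def B_def using X Y by (auto intro!: load_nonneg[where M = M])
    have "(\<Sum>j\<in>?J. (a j i t + b j i t) powr \<alpha> - a j i t powr \<alpha>) \<le>
        (\<Sum>j\<in>?J. \<alpha> * b j i t * (A + B) powr (\<alpha> - 1))"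
    proof (rule sum_mono)
      fix j assume j: "j \<in> ?J"
      have a: "0 \<le> a j i t" "a j i t \<le> A"
        unfolding a_def A_def using X sub fin
        by (auto intro!: load_nonneg[where M = M] load_mono[where M = M])
      have bn: "0 \<le> b k i t" if "k \<in> ?J" for k
        unfolding b_def using run_speed_nonneg[OF Y[OF that]] .
      have b: "b j i t \<le> B"
        unfolding B_def load_def b_def[symmetric] using fin j bn by (intro member_le_sum) auto
      have "(a j i t + b j i t) powr \<alpha> - a j i t powr \<alpha> \<le>
          \<alpha> * b j i t * (a j i t + b j i t) powr (\<alpha> - 1)"
        using \<alpha> a bn[OF j] by (intro powr_increment_le) auto
      \<comment> \<open>A base common to all jobs makes the bound linear in the speeds
        \<open>b j i t\<close>, so it can be summed.\<close>
      also have "\<dots> \<le> \<alpha> * b j i t * (A + B) powr (\<alpha> - 1)"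
        using \<alpha> a b bn[OF j] by (intro mult_left_mono powr_mono2) auto
      finally show "(a j i t + b j i t) powr \<alpha> - a j i t powr \<alpha> \<le>
          \<alpha> * b j i t * (A + B) powr (\<alpha> - 1)" .
    qed
    also have "\<dots> = \<alpha> * B * (A + B) powr (\<alpha> - 1)"
      unfolding B_def load_def b_def by (simp add: sum_distrib_left sum_distrib_right)
    also have "\<dots> \<le> l * B powr \<alpha> + A powr \<alpha> / 4" using l AB by blast
    finally show ?thesis unfolding A_def B_def .
  qed
  have "(\<Sum>j\<in>?J. load_energy \<alpha> M I (X(j := Y j)) (insert j (earlier I j)) -
        load_energy \<alpha> M I X (earlier I j)) =
      (\<Sum>j\<in>?J. \<Sum>i\<in>M. LBINT t:{0..}. (a j i t + b j i t) powr \<alpha> - a j i t powr \<alpha>)"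
    using ins by (intro sum.cong) auto
  \<comment> \<open>Exchanging the sums, and then sum and integral, brings the jobs inside the
    integral, where \<open>pw\<close> applies.\<close>
  also have "\<dots> = (\<Sum>i\<in>M. \<Sum>j\<in>?J. LBINT t:{0..}. (a j i t + b j i t) powr \<alpha> - a j i t powr \<alpha>)"
    by (rule sum.swap)
  also have "\<dots> = (\<Sum>i\<in>M. LBINT t:{0..}. \<Sum>j\<in>?J. (a j i t + b j i t) powr \<alpha> - a j i t powr \<alpha>)"
    using int unfolding set_integrable_def set_lebesgue_integral_def
    by (intro sum.cong refl) (simp add: sum_distrib_left Bochner_Integration.integral_sum)
  also have "\<dots> \<le> (\<Sum>i\<in>M. LBINT t:{0..}. l * load I Y ?J i t powr \<alpha> + load I X ?J i t powr \<alpha> / 4)"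
  proof (intro sum_mono set_integral_mono pw)
    fix i
    show "set_integrable lborel {0..} (\<lambda>t. \<Sum>j\<in>?J. (a j i t + b j i t) powr \<alpha> - a j i t powr \<alpha>)"
      using int unfolding set_integrable_def
      by (simp add: sum_distrib_left Bochner_Integration.integrable_sum)
    show "set_integrable lborel {0..} (\<lambda>t. l * load I Y ?J i t powr \<alpha> + load I X ?J i t powr \<alpha> / 4)"
      using iX iY by (intro set_integral_add set_integrable_mult_right set_integrable_divide) auto
  qed
  also have "\<dots> = l * load_energy \<alpha> M I Y ?J + load_energy \<alpha> M I X ?J / 4"
    unfolding load_energy_def sum_distrib_left sum_divide_distrib sum.distrib[symmetric]
    using iX iY by (intro sum.cong refl) (simp add: set_integral_add(2))
  finally show ?thesis unfolding marginal_def by (simp add: sum.distrib)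
qed

text \<open>Comparing each greedy choice with \<open>Y j\<close> costs a factor 2, which turns the
  quarter of the greedy energy into a half; that half is absorbed on the left.\<close>

lemma greedy_competitive:
  assumes \<alpha>: "1 < \<alpha>" and M: "finite M" "M \<noteq> {}" and I: "valid_instance M I"
    and Y: "\<And>j. j \<in> jobs I \<Longrightarrow> valid_run M I j (Y j)"
    and l: "0 < l"
      "\<And>a b. 0 \<le> a \<Longrightarrow> 0 \<le> b \<Longrightarrow> \<alpha> * b * (a + b) powr (\<alpha> - 1) \<le> l * b powr \<alpha> + a powr \<alpha> / 4"
  shows "assignment_cost \<alpha> M I (greedy \<alpha> M I) \<le> 4 * (1 + l) * assignment_cost \<alpha> M I Y"
proof -
  let ?G = "greedy \<alpha> M I"
  define FG FY EG EY where
    "FG = (\<Sum>j\<in>jobs I. weight I j * (completion I j (?G j) - release I j))" and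
    "FY = (\<Sum>j\<in>jobs I. weight I j * (completion I j (Y j) - release I j))" and
    "EG = load_energy \<alpha> M I ?G (jobs I)" and
    "EY = load_energy \<alpha> M I Y (jobs I)"
  have fin: "finite (jobs I)" using I by (simp add: valid_instance_def)
  have flow: "0 \<le> (\<Sum>j\<in>jobs I. weight I j * (completion I j (Z j) - release I j))"
    if "\<And>j. j \<in> jobs I \<Longrightarrow> valid_run M I j (Z j)" for Z
  proof (intro sum_nonneg mult_nonneg_nonneg)
    fix j assume j: "j \<in> jobs I"
    show "0 \<le> weight I j" using I j by (auto simp: valid_instance_def intro: less_imp_le)
    show "0 \<le> completion I j (Z j) - release I j"
      using completion_gt_start[OF I j that[OF j]] that[OF j] by (auto simp: valid_run_def)
  qed
  note valid = greedy_valid[OF \<alpha> M I]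
  have nn: "0 \<le> FG" "0 \<le> FY" "0 \<le> EG" "0 \<le> EY"
    unfolding FG_def FY_def EG_def EY_def using flow Y valid load_energy_nonneg by auto
  have "FG + EG = (\<Sum>j\<in>jobs I. marginal \<alpha> M I ?G j (?G j))"
    using assignment_cost_eq_marginals[OF fin] unfolding assignment_cost_def FG_def EG_def by auto
  also have "\<dots> \<le> (\<Sum>j\<in>jobs I. 2 * marginal \<alpha> M I ?G j (Y j))"
    using greedy_nearly_best[OF \<alpha> M I] Y by (intro sum_mono) (auto simp: nearly_best_def)
  also have "\<dots> \<le> 2 * (FY + l * EY + EG / 4)"
    unfolding sum_distrib_left[symmetric] FY_def EG_def EY_def
    using marginal_sum_le[OF \<alpha> M(1) fin valid Y l(2)] by simp
  \<comment> \<open>Moving \<open>EG / 2\<close> to the left leaves \<open>FG + EG / 2\<close>, at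
    least half of \<open>FG + EG\<close> because \<open>FG \<ge> 0\<close>; doubling gives the
    factor 4.\<close>
  finally have "FG + EG \<le> 4 * FY + 4 * (l * EY)" using nn by simp
  also have "\<dots> \<le> 4 * (1 + l) * (FY + EY)"
    using nn l(1) by (simp add: algebra_simps)
  finally show ?thesis
    unfolding assignment_cost_def FG_def FY_def EG_def EY_def .
qed

theorem theorem2:
  fixes \<alpha> :: real
  assumes "1 < \<alpha>"
  shows "\<exists>C>0. \<forall>(\<epsilon>::real)>0. \<forall>M. finite M \<longrightarrow> M \<noteq> {} \<longrightarrow>
    (\<exists>A. online_algorithm M A \<and>
      (\<forall>I. valid_instance M I \<longrightarrow>
         (\<Sum>j\<in>rejected I (A I). weight I j) \<le> \<epsilon> * (\<Sum>j\<in>jobs I. weight I j) \<and>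
         cost \<alpha> M I (A I) \<le> C * (1 + 1 / \<epsilon>) powr (\<alpha> / (\<alpha> - 1)) * opt_cost \<alpha> M I))"
proof -
  obtain l where l: "0 < l"
    "\<And>a b. 0 \<le> a \<Longrightarrow> 0 \<le> b \<Longrightarrow> \<alpha> * b * (a + b) powr (\<alpha> - 1) \<le> l * b powr \<alpha> + a powr \<alpha> / 4"
    using powr_young[OF assms] by blast
  \<comment> \<open>\<open>C\<close> is fixed before \<open>\<epsilon>\<close>, \<open>M\<close> and
    the instance; it depends on \<open>\<alpha>\<close> only.\<close>
  define C where "C = 4 * (1 + l)"
  have C: "0 < C" unfolding C_def using l by simp
  show ?thesis
  proof (intro exI[of _ C] conjI allI impI C)
    fix \<epsilon> :: real and M :: "nat set"
    assume \<epsilon>: "0 < \<epsilon>" and M: "finite M" "M \<noteq> {}"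
    define A where "A I = \<lparr>run_of = \<lambda>j. Some (greedy \<alpha> M I j), reject_at = \<lambda>_. None\<rparr>" for I
    have sel: "run_of (A I) j = Some (greedy \<alpha> M I j)" "reject_at (A I) j = None" for I j
      by (simp_all add: A_def)
    have rej: "rejected I (A I) = {}" for I by (simp add: rejected_def sel)
    have feas: "feasible M I (A I)" if "valid_instance M I" for I
      using greedy_valid[OF assms M that] by (simp add: feasible_def sel)
    show "\<exists>A. online_algorithm M A \<and>
      (\<forall>I. valid_instance M I \<longrightarrow>
         (\<Sum>j\<in>rejected I (A I). weight I j) \<le> \<epsilon> * (\<Sum>j\<in>jobs I. weight I j) \<and>
         cost \<alpha> M I (A I) \<le> C * (1 + 1 / \<epsilon>) powr (\<alpha> / (\<alpha> - 1)) * opt_cost \<alpha> M I)"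
    proof (intro exI[of _ A] conjI allI impI)
      show "online_algorithm M A"
        unfolding online_algorithm_def run_by_def reject_by_def sel
        using feas greedy_non_anticipating[OF assms M] by simp
    next
      fix I assume I: "valid_instance M I"
      show "(\<Sum>j\<in>rejected I (A I). weight I j) \<le> \<epsilon> * (\<Sum>j\<in>jobs I. weight I j)"
        unfolding rej sum.empty using \<epsilon> I
        by (intro mult_nonneg_nonneg sum_nonneg) (auto simp: valid_instance_def intro: less_imp_le)
      \<comment> \<open>\<open>opt_cost\<close> is an infimum, so the quotient is shown to be a
        lower bound for the cost of every schedule without rejections.\<close>
      have le: "cost \<alpha> M I (A I) / C \<le> opt_cost \<alpha> M I"
        unfolding opt_cost_def
      proof (rule cInf_greatest)
        show "{cost \<alpha> M I S |S. feasible M I S \<and> rejected I S = {}} \<noteq> {}"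
          using feas[OF I] rej by blast
        fix c assume "c \<in> {cost \<alpha> M I S |S. feasible M I S \<and> rejected I S = {}}"
        then obtain S where S: "c = cost \<alpha> M I S" "feasible M I S" "rejected I S = {}" by blast
        have "cost \<alpha> M I (A I) \<le> C * c"
          unfolding S(1) cost_no_rejection(1)[OF S(2,3)]
            cost_no_rejection(1)[OF feas[OF I] rej] sel option.sel C_def
          by (intro greedy_competitive assms M I l cost_no_rejection(2)[OF S(2,3)])
        then show "cost \<alpha> M I (A I) / C \<le> c" using C by (simp add: field_simps)
      qed
      have "0 \<le> weight I j * flow_time I (A I) j" if "j \<in> jobs I" for j
        using completion_gt_start[OF I that greedy_valid[OF assms M I that]]
          greedy_valid[OF assms M I that] I that
        by (auto simp: flow_time_def sel valid_run_def valid_instance_def)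
      then have "0 \<le> cost \<alpha> M I (A I)"
        unfolding cost_def energy_def set_lebesgue_integral_def
        by (intro add_nonneg_nonneg sum_nonneg integral_nonneg_AE) auto
      \<comment> \<open>The sign is needed to enlarge the factor in front of
        \<open>opt_cost\<close>.\<close>
      then have opt: "0 \<le> opt_cost \<alpha> M I" using le C by (smt (verit) divide_nonneg_pos)
      \<comment> \<open>Base at least 1 and positive exponent: the bound with \<open>C\<close> alone
        implies the claimed one.\<close>
      have "1 \<le> (1 + 1 / \<epsilon>) powr (\<alpha> / (\<alpha> - 1))"
        using \<epsilon> assms by (intro ge_one_powr_ge_zero) auto
      then have "C * 1 * opt_cost \<alpha> M I \<le> C * (1 + 1 / \<epsilon>) powr (\<alpha> / (\<alpha> - 1)) * opt_cost \<alpha> M I"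
        using C opt by (intro mult_right_mono mult_left_mono) auto
      moreover have "cost \<alpha> M I (A I) \<le> C * opt_cost \<alpha> M I"
        using le C by (simp add: field_simps)
      ultimately show "cost \<alpha> M I (A I) \<le> C * (1 + 1 / \<epsilon>) powr (\<alpha> / (\<alpha> - 1)) * opt_cost \<alpha> M I"
        by simp
    qed
  qed
qed

end
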